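(* Let $n\geq 1$, let $\mathcal{X}$ be the space in which individual data points take values, and let $(p_r)$ be a probability distribution over bags $r$ (finite sequences of indices in $[n]$) with $\pi_i<1$ for all $i\in[n]$. Let $\mathcal{A}$ be any base algorithm which maps finite sequences of elements of $\mathcal{X}$ to $[0,1]$. Then the bagged algorithm $\mathcal{A}_{\mathrm{bag}}$ satisfies \[\sup_{z=(z_1,\dots,z_n)\in\mathcal{X}^n}\ \frac1n\sum_{i=1}^n\big(\mathcal{A}_{\mathrm{bag}}(z)-\mathcal{A}_{\mathrm{bag}}(z_{-i})\big)^2\leq\frac14\|M_{\mathrm{bag}}\|_2,\] where $\|\cdot\|_2$ is the usual matrix operator (spectral) norm and $M_{\mathrm{bag}}\in\mathbb{R}^{n\times n}$ is the matrix with entries \[(M_{\mathrm{bag}})_{ij}=\frac1n\,\frac{\Sigma_{ij}}{(1-\pi_i)(1-\pi_j)}.\]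
   Context: Write $[n]=\{1,\dots,n\}$. A bag is a finite sequence $r=(i_1,\dots,i_m)$ of arbitrary length with entries in $[n]$ (repetitions allowed); $i\in r$ means that $i$ appears among the entries of $r$. For a data vector $z=(z_1,\dots,z_n)$, set $z_r=(z_{i_1},\dots,z_{i_m})$, and let $z_{-i}=(z_1,\dots,z_{i-1},z_{i+1},\dots,z_n)$ be the data with the $i$th point deleted. The number $p_r$ is the probability of selecting bag $r$. Bagged algorithm on the full data: \[\mathcal{A}_{\mathrm{bag}}(z)=\sum_r p_r\,\mathcal{A}(z_r).\] Bagged algorithm on the data with point $i$ deleted (standing assumption: sampling a bag from $[n]\setminus\{i\}$ is the same as sampling a bag $r$ with probabilities $p_r$ conditionally on $i\notin r$): \[\mathcal{A}_{\mathrm{bag}}(z_{-i})=\frac{\sum_r \mathbf{1}\{i\notin r\}\,p_r\,\mathcal{A}(z_r)}{\sum_r\mathbf{1}\{i\notin r\}\,p_r}.\] Define $\pi_i=\sum_r\mathbf{1}\{i\in r\}\,p_r$ and $\Sigma_{ij}=\sum_r\mathbf{1}\{i\in r \text{ and } j\in r\}\,p_r-\pi_i\pi_j$. *)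

theory Defs
  imports "HOL-Probability.Probability"
begin

text \<open>
  The finite type \<open>'n\<close> plays the role of \<open>[n]\<close>, so \<open>n = CARD('n)\<close>, which is at least 1 because
  types are nonempty. Data vectors in \<open>X\<^sup>n\<close> have type \<open>'x ^ 'n\<close>, bags have type \<open>'n list\<close>, and the
  distribution over bags is a \<open>pmf\<close>. Since the set of bags is countably infinite, the sums over bags
  are unordered infinite sums; for base algorithms with values in \<open>[0,1]\<close> they all converge.
\<close>

definition sub_data :: "'x ^ 'n \<Rightarrow> 'n list \<Rightarrow> 'x list" where
  "sub_data z r = map (\<lambda>i. z $ i) r"

definition bagged :: "'n list pmf \<Rightarrow> ('x list \<Rightarrow> real) \<Rightarrow> 'x ^ 'n \<Rightarrow> real" where
  "bagged p A z = (\<Sum>\<^sub>\<infinity>r. pmf p r * A (sub_data z r))"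

text \<open>
  \<open>bagged_del p A z i\<close> is the bagged algorithm run on \<open>z\<close> with its \<open>i\<close>th point deleted: bags are
  sampled from \<open>p\<close> conditionally on not containing \<open>i\<close>. The remaining points keep their original
  indices, and the value does not depend on \<open>z $ i\<close>.
\<close>

definition bagged_del :: "'n list pmf \<Rightarrow> ('x list \<Rightarrow> real) \<Rightarrow> 'x ^ 'n \<Rightarrow> 'n \<Rightarrow> real" where
  "bagged_del p A z i =
     (\<Sum>\<^sub>\<infinity>r. of_bool (i \<notin> set r) * pmf p r * A (sub_data z r)) /
     (\<Sum>\<^sub>\<infinity>r. of_bool (i \<notin> set r) * pmf p r)"

definition incl_prob :: "'n list pmf \<Rightarrow> 'n \<Rightarrow> real" where
  "incl_prob p i = (\<Sum>\<^sub>\<infinity>r. of_bool (i \<in> set r) * pmf p r)"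

definition incl_cov :: "'n list pmf \<Rightarrow> 'n \<Rightarrow> 'n \<Rightarrow> real" where
  "incl_cov p i j =
     (\<Sum>\<^sub>\<infinity>r. of_bool (i \<in> set r \<and> j \<in> set r) * pmf p r) - incl_prob p i * incl_prob p j"

definition M_bag :: "'n list pmf \<Rightarrow> real ^ 'n ^ 'n" where
  "M_bag p = (\<chi> i j. 1 / real CARD('n) *
     (incl_cov p i j / ((1 - incl_prob p i) * (1 - incl_prob p j))))"

text \<open>
  The Euclidean operator norm; the instance \<open>norm\<close> on the type of matrices is the Frobenius norm.
\<close>

definition spectral_norm :: "real ^ 'n ^ 'm \<Rightarrow> real" where
  "spectral_norm M = onorm (\<lambda>x. M *v x)"

end

theory Submission imports Defs begin

text \<open>
  Write \<open>E\<close> for the expectation over a random bag \<open>r\<close>, let \<open>f r = A (sub_data z r)\<close>, and let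
  \<open>W r\<close> be the random vector with entries \<open>(of_bool (i \<in> set r) - incl_prob p i) / (1 - incl_prob p i)\<close>.
  Each entry of \<open>W\<close> has mean zero, and the change in the bagged algorithm when the point \<open>i\<close> is
  deleted is \<open>d\<^sub>i = E [W\<^sub>i f] = E [W\<^sub>i (f - 1/2)]\<close>. Moreover \<open>M_bag p\<close> is \<open>1/n\<close> times
  the second-moment matrix \<open>C\<close> of \<open>W\<close>; below, \<open>\<parallel>C\<parallel>\<close> is its spectral norm.

  Let \<open>S = \<Sum>\<^sub>i d\<^sub>i\<^sup>2\<close> and let \<open>Y = W \<bullet> d\<close>. Then \<open>S = E [Y (f - 1/2)]\<close> and
  \<open>E [Y\<^sup>2] = d \<bullet> (C *v d) \<le> \<parallel>C\<parallel> S\<close>. As \<open>(f - 1/2)\<^sup>2 \<le> 1/4\<close>, the Cauchy--Schwarz inequality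
  gives \<open>S\<^sup>2 \<le> E [Y\<^sup>2] / 4 \<le> \<parallel>C\<parallel> S / 4\<close>, hence \<open>S \<le> \<parallel>C\<parallel> / 4\<close>. This is
  \<open>sum_correlations_le\<close>; it holds for any bounded random vector and does not involve bags.
\<close>

lemma integrable_measure_pmf_bounded:
  fixes f :: "'a \<Rightarrow> real"
  assumes "\<And>x. \<bar>f x\<bar> \<le> B"
  shows "integrable (measure_pmf p) f"
  using assms by (intro measure_pmf.integrable_const_bound[where B = B]) auto

lemma infsum_pmf_eq_expectation:
  fixes f :: "'a \<Rightarrow> real"
  assumes "\<And>x. \<bar>f x\<bar> \<le> B"
  shows "(\<Sum>\<^sub>\<infinity>x. pmf p x * f x) = measure_pmf.expectation p f"
proof -
  have "integrable (density (count_space UNIV) (\<lambda>x. ennreal (pmf p x))) f"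
    using integrable_measure_pmf_bounded[OF assms, of p] measure_pmf_eq_density[of p] by simp
  then have "integrable (count_space UNIV) (\<lambda>x. pmf p x * f x)"
    by (subst (asm) integrable_density) auto
  then have "Infinite_Set_Sum.abs_summable_on (\<lambda>x. pmf p x * f x) UNIV"
    by (simp add: Infinite_Set_Sum.abs_summable_on_def)
  then have "infsetsum (\<lambda>x. pmf p x * f x) UNIV = (\<Sum>\<^sub>\<infinity>x. pmf p x * f x)"
    by (rule infsetsum_infsum)
  then show ?thesis
    by (simp add: pmf_expectation_eq_infsetsum)
qed

lemma inner_matrix_vector_le_spectral_norm:
  fixes C :: "real ^ 'n ^ 'n"
  shows "d \<bullet> (C *v d) \<le> spectral_norm C * (norm d)\<^sup>2"
proof -
  have "d \<bullet> (C *v d) \<le> norm d * norm (C *v d)"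
    by (rule norm_cauchy_schwarz)
  also have "\<dots> \<le> norm d * (spectral_norm C * norm d)"
    unfolding spectral_norm_def
    by (intro mult_left_mono onorm[OF matrix_vector_mul_bounded_linear] norm_ge_zero)
  finally show ?thesis
    by (simp add: power2_eq_square mult_ac)
qed

text \<open>
  For a bounded random vector \<open>W\<close> and a random variable \<open>g\<close> with \<open>g\<^sup>2 \<le> 1/4\<close>, the correlations of
  the entries of \<open>W\<close> with \<open>g\<close> are controlled by the second-moment matrix \<open>C\<close> of \<open>W\<close>.
\<close>

lemma sum_correlations_le:
  fixes p :: "'a pmf" and W :: "'n::finite \<Rightarrow> 'a \<Rightarrow> real" and g :: "'a \<Rightarrow> real"
    and C :: "real ^ 'n ^ 'n"
  assumes W: "\<And>i x. \<bar>W i x\<bar> \<le> B i"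
    and g: "\<And>x. \<bar>g x\<bar> \<le> 1 / 2"
    and C: "\<And>i j. C $ i $ j = measure_pmf.expectation p (\<lambda>x. W i x * W j x)"
  shows "(\<Sum>i\<in>UNIV. (measure_pmf.expectation p (\<lambda>x. W i x * g x))\<^sup>2) \<le> 1 / 4 * spectral_norm C"
proof -
  define d :: "real ^ 'n" where "d = (\<chi> i. measure_pmf.expectation p (\<lambda>x. W i x * g x))"
  define S where "S = (\<Sum>i\<in>UNIV. (d $ i)\<^sup>2)"
  define Y where "Y x = (\<Sum>i\<in>UNIV. d $ i * W i x)" for x
  have S_norm: "S = (norm d)\<^sup>2"
    unfolding S_def power2_norm_eq_inner by (simp add: inner_vec_def power2_eq_square)
  have S_nonneg: "S \<ge> 0"
    by (simp add: S_norm)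
  have B_nonneg: "0 \<le> B i" for i
    using W[of i undefined] by linarith
  have intWg: "integrable (measure_pmf p) (\<lambda>x. W i x * g x)" for i
    by (rule integrable_measure_pmf_bounded[where B = "B i * (1/2)"])
      (unfold abs_mult, intro mult_mono W g B_nonneg abs_ge_zero)
  have intWW: "integrable (measure_pmf p) (\<lambda>x. W i x * W j x)" for i j
    by (rule integrable_measure_pmf_bounded[where B = "B i * B j"])
      (unfold abs_mult, intro mult_mono W B_nonneg abs_ge_zero)
  have g_sq: "(g x)\<^sup>2 \<le> 1 / 4" for x
    using power_mono[OF g[of x], of 2] by (simp add: power2_eq_square)
  have int_gg: "integrable (measure_pmf p) (\<lambda>x. (g x)\<^sup>2)"
    by (rule integrable_measure_pmf_bounded[where B = "1/4"]) (use g_sq in simp)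
  have Eg: "measure_pmf.expectation p (\<lambda>x. (g x)\<^sup>2) \<le> 1 / 4"
    by (rule measure_pmf.integral_le_const[OF int_gg]) (use g_sq in simp)

  have Yg: "Y x * g x = (\<Sum>i\<in>UNIV. d $ i * (W i x * g x))" for x
    by (simp add: Y_def sum_distrib_right mult.assoc)
  have int_Yg: "integrable (measure_pmf p) (\<lambda>x. Y x * g x)"
    unfolding Yg by (intro Bochner_Integration.integrable_sum integrable_mult_right intWg)
  have E_Yg: "measure_pmf.expectation p (\<lambda>x. Y x * g x) = S"
    unfolding Yg S_def
    by (simp add: Bochner_Integration.integral_sum intWg d_def power2_eq_square)

  have YY: "(Y x)\<^sup>2 = (\<Sum>i\<in>UNIV. \<Sum>j\<in>UNIV. d $ i * d $ j * (W i x * W j x))" for x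
    by (simp add: Y_def power2_eq_square sum_product mult_ac)
  have int_YY: "integrable (measure_pmf p) (\<lambda>x. (Y x)\<^sup>2)"
    unfolding YY by (intro Bochner_Integration.integrable_sum integrable_mult_right intWW)
  have "measure_pmf.expectation p (\<lambda>x. (Y x)\<^sup>2) = d \<bullet> (C *v d)"
    unfolding YY
    by (simp add: Bochner_Integration.integral_sum intWW C inner_vec_def
        matrix_vector_mult_def sum_distrib_left mult_ac)
  also have "\<dots> \<le> spectral_norm C * S"
    unfolding S_norm by (rule inner_matrix_vector_le_spectral_norm)
  finally have E_YY: "measure_pmf.expectation p (\<lambda>x. (Y x)\<^sup>2) \<le> spectral_norm C * S" .

  \<comment> \<open>Cauchy--Schwarz for \<open>Y\<close> and \<open>g\<close>, in the form \<open>0 \<le> E [(Y - t g)\<^sup>2]\<close>; the choice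
    \<open>t = 4 S\<close> minimises the upper bound \<open>E [Y\<^sup>2] - 2 t S + t\<^sup>2 / 4\<close>.\<close>
  have "0 \<le> measure_pmf.expectation p (\<lambda>x. (Y x - 4 * S * g x)\<^sup>2)"
    by simp
  also have "(\<lambda>x. (Y x - 4 * S * g x)\<^sup>2)
      = (\<lambda>x. (Y x)\<^sup>2 - 8 * S * (Y x * g x) + 16 * S\<^sup>2 * (g x)\<^sup>2)"
    by (simp add: fun_eq_iff power2_eq_square algebra_simps)
  also have "measure_pmf.expectation p \<dots> = measure_pmf.expectation p (\<lambda>x. (Y x)\<^sup>2)
      - 8 * S * S + 16 * S\<^sup>2 * measure_pmf.expectation p (\<lambda>x. (g x)\<^sup>2)"
    by (simp add: int_YY int_Yg int_gg E_Yg)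
  also have "\<dots> \<le> spectral_norm C * S - 8 * S * S + 16 * S\<^sup>2 * (1 / 4)"
    using E_YY Eg by (intro add_mono diff_right_mono mult_left_mono) auto
  finally have "S * (4 * S) \<le> S * spectral_norm C"
    by (simp add: power2_eq_square algebra_simps)
  moreover have "0 \<le> spectral_norm C"
    unfolding spectral_norm_def by (rule onorm_pos_le[OF matrix_vector_mul_bounded_linear])
  ultimately have "4 * S \<le> spectral_norm C"
    using S_nonneg by (cases "S = 0") (auto simp: mult_le_cancel_left)
  then show ?thesis
    by (simp add: S_def d_def)
qed

lemma spectral_norm_scaleR: "spectral_norm (c *\<^sub>R C) = \<bar>c\<bar> * spectral_norm C"
  unfolding spectral_norm_def scaleR_matrix_vector_assoc[symmetric]
  by (rule onorm_scaleR[OF matrix_vector_mul_bounded_linear])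

lemma incl_prob_eq_expectation:
  "incl_prob p i = measure_pmf.expectation p (\<lambda>r. of_bool (i \<in> set r))"
  unfolding incl_prob_def
  using infsum_pmf_eq_expectation[of "\<lambda>r. of_bool (i \<in> set r)" 1 p]
  by (simp add: mult.commute)

text \<open>
  The indicator that the point \<open>i\<close> lies in a random bag, centred at its mean and divided by the
  probability that the bag misses \<open>i\<close>. This is the entry \<open>W\<^sub>i\<close> of the random vector \<open>W\<close> above.
\<close>

definition centred_incl :: "'n list pmf \<Rightarrow> 'n \<Rightarrow> 'n list \<Rightarrow> real" where
  "centred_incl p i r = (of_bool (i \<in> set r) - incl_prob p i) / (1 - incl_prob p i)"

lemma integrable_incl [simp]:
  "integrable (measure_pmf p) (\<lambda>r. of_bool (P r) :: real)"
  by (rule integrable_measure_pmf_bounded[where B = 1]) simp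

lemma expectation_centred_incl [simp]:
  "measure_pmf.expectation p (centred_incl p i) = 0"
  unfolding centred_incl_def[abs_def] by (simp add: incl_prob_eq_expectation[symmetric])

lemma abs_centred_incl_le:
  "\<bar>centred_incl p i r\<bar> \<le> (1 + \<bar>incl_prob p i\<bar>) / \<bar>1 - incl_prob p i\<bar>"
  unfolding centred_incl_def abs_divide by (intro divide_right_mono) auto

lemma expectation_centred_incl_mult:
  "measure_pmf.expectation p (\<lambda>r. centred_incl p i r * centred_incl p j r)
    = incl_cov p i j / ((1 - incl_prob p i) * (1 - incl_prob p j))"
proof -
  let ?E = "measure_pmf.expectation p"
  have cov: "incl_cov p i j = ?E (\<lambda>r. of_bool (i \<in> set r \<and> j \<in> set r))
      - incl_prob p i * incl_prob p j"
    unfolding incl_cov_def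
    using infsum_pmf_eq_expectation[of "\<lambda>r. of_bool (i \<in> set r \<and> j \<in> set r)" 1 p]
    by (simp add: mult.commute)
  have "?E (\<lambda>r. (of_bool (i \<in> set r) - incl_prob p i) * (of_bool (j \<in> set r) - incl_prob p j))
      = ?E (\<lambda>r. of_bool (i \<in> set r \<and> j \<in> set r) - incl_prob p j * of_bool (i \<in> set r)
          - incl_prob p i * of_bool (j \<in> set r) + incl_prob p i * incl_prob p j)"
    by (simp add: of_bool_conj algebra_simps)
  also have "\<dots> = incl_cov p i j"
    by (simp add: cov incl_prob_eq_expectation[symmetric])
  finally show ?thesis
    by (simp add: centred_incl_def)
qed

lemma bagged_diff_eq_expectation:
  fixes p :: "'n::finite list pmf"
  assumes p: "incl_prob p i < 1"
    and A: "\<And>xs. A xs \<in> {0..1}"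
  shows "bagged p A z - bagged_del p A z i
    = measure_pmf.expectation p (\<lambda>r. centred_incl p i r * (A (sub_data z r) - 1 / 2))"
proof -
  let ?E = "measure_pmf.expectation p"
  let ?f = "\<lambda>r. A (sub_data z r)"
  have f: "\<bar>?f r\<bar> \<le> 1" for r
    using A[of "sub_data z r"] by simp
  have f': "\<bar>of_bool (P r) * ?f r\<bar> \<le> 1" for P r
    using f[of r] by simp
  have int_f [simp]: "integrable (measure_pmf p) ?f"
    by (rule integrable_measure_pmf_bounded[OF f])
  have int_f' [simp]: "integrable (measure_pmf p) (\<lambda>r. of_bool (P r) * ?f r)" for P
    by (rule integrable_measure_pmf_bounded[OF f'])
  have full: "bagged p A z = ?E ?f"
    unfolding bagged_def by (rule infsum_pmf_eq_expectation[OF f])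
  have num: "(\<Sum>\<^sub>\<infinity>r. of_bool (i \<notin> set r) * pmf p r * ?f r)
      = ?E ?f - ?E (\<lambda>r. of_bool (i \<in> set r) * ?f r)"
  proof -
    have "(\<Sum>\<^sub>\<infinity>r. of_bool (i \<notin> set r) * pmf p r * ?f r)
        = (\<Sum>\<^sub>\<infinity>r. pmf p r * (of_bool (i \<notin> set r) * ?f r))"
      by (simp only: mult_ac)
    also have "\<dots> = ?E (\<lambda>r. of_bool (i \<notin> set r) * ?f r)"
      by (rule infsum_pmf_eq_expectation) (rule f')
    also have "\<dots> = ?E (\<lambda>r. ?f r - of_bool (i \<in> set r) * ?f r)"
      by (simp add: of_bool_not_iff left_diff_distrib)
    finally show ?thesis
      by simp
  qed
  have den: "(\<Sum>\<^sub>\<infinity>r. of_bool (i \<notin> set r) * pmf p r) = 1 - incl_prob p i"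
    using infsum_pmf_eq_expectation[of "\<lambda>r. of_bool (i \<notin> set r)" 1 p]
    by (simp add: of_bool_not_iff algebra_simps incl_prob_eq_expectation)
  have "bagged p A z - bagged_del p A z i
      = (?E (\<lambda>r. of_bool (i \<in> set r) * ?f r) - incl_prob p i * ?E ?f) / (1 - incl_prob p i)"
    unfolding bagged_del_def num den full using p by (simp add: field_simps)
  also have "\<dots> = ?E (\<lambda>r. (of_bool (i \<in> set r) * ?f r - incl_prob p i * ?f r) / (1 - incl_prob p i))"
    by simp
  also have "\<dots> = ?E (\<lambda>r. centred_incl p i r * ?f r)"
    by (simp add: centred_incl_def algebra_simps)
  \<comment> \<open>Shifting \<open>f\<close> by a constant changes nothing, because \<open>centred_incl p i\<close> has mean zero.\<close>
  also have "\<dots> = ?E (\<lambda>r. centred_incl p i r * ?f r) - ?E (\<lambda>r. centred_incl p i r * (1 / 2))"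
    by simp
  also have "\<dots> = ?E (\<lambda>r. centred_incl p i r * ?f r - centred_incl p i r * (1 / 2))"
    by (rule Bochner_Integration.integral_diff[symmetric])
      (simp_all add: centred_incl_def diff_divide_distrib left_diff_distrib)
  also have "\<dots> = ?E (\<lambda>r. centred_incl p i r * (?f r - 1 / 2))"
    by (simp add: right_diff_distrib)
  finally show ?thesis .
qed

theorem proposition5:
  fixes p :: "'n::finite list pmf"
    and A :: "'x list \<Rightarrow> real"
  assumes "\<And>i. incl_prob p i < 1"
    and "\<And>xs. A xs \<in> {0..1}"
  shows "(SUP z :: 'x ^ 'n. ereal (1 / real CARD('n) *
            (\<Sum>i\<in>UNIV. (bagged p A z - bagged_del p A z i)\<^sup>2)))
         \<le> ereal (1 / 4 * spectral_norm (M_bag p))"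
proof (rule SUP_least)
  fix z :: "'x ^ 'n"
  define C :: "real ^ 'n ^ 'n" where
    "C = (\<chi> i j. measure_pmf.expectation p (\<lambda>r. centred_incl p i r * centred_incl p j r))"
  have M: "M_bag p = (1 / real CARD('n)) *\<^sub>R C"
    by (simp add: vec_eq_iff M_bag_def C_def expectation_centred_incl_mult)
  have g: "\<bar>A (sub_data z r) - 1 / 2\<bar> \<le> 1 / 2" for r
    unfolding abs_le_iff using assms(2)[of "sub_data z r"] by simp
  have "(\<Sum>i\<in>UNIV. (bagged p A z - bagged_del p A z i)\<^sup>2) \<le> 1 / 4 * spectral_norm C"
    unfolding bagged_diff_eq_expectation[OF assms]
    by (rule sum_correlations_le[OF abs_centred_incl_le g]) (simp add: C_def)
  then have "1 / real CARD('n) * (\<Sum>i\<in>UNIV. (bagged p A z - bagged_del p A z i)\<^sup>2)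
      \<le> 1 / real CARD('n) * (1 / 4 * spectral_norm C)"
    by (intro mult_left_mono) simp_all
  then show "ereal (1 / real CARD('n) * (\<Sum>i\<in>UNIV. (bagged p A z - bagged_del p A z i)\<^sup>2))
      \<le> ereal (1 / 4 * spectral_norm (M_bag p))"
    by (simp add: M spectral_norm_scaleR mult.commute)
qed

end
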